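(* Let $A$ be an $n\times n$ irreducible, nonnegative, positive semidefinite matrix and $\mathbf{x}\in\mathbb{R}^n_{++}$. Let $i_1$ be a log-concavity index and $i_2$ a log-convexity index of $A$ associated with $\mathbf{x}$ (such indices exist), and let $g_k=(A^k\mathbf{x})_{i_1}$ and $h_k=(A^k\mathbf{x})_{i_2}$ for $k\ge0$. Assume that the rows $\mathbf{e}_{i_1}^TA$ and $\mathbf{e}_{i_2}^TA$ are (entrywise) positive, and that $A^r\mathbf{x}$ is not a Perron vector of $A$ for every $r\ge0$. Then: (i) there exists $k_1\ge1$ such that $(a_k(A,\mathbf{x}))_{k\ge k_1}$ is strictly decreasing and $(g_k)_{k\ge k_1-1}$ is strictly log-concave; (ii) there exists $k_2\ge1$ such that $(b_k(A,\mathbf{x}))_{k\ge k_2}$ is strictly increasing and $(h_k)_{k\ge k_2-1}$ is strictly log-convex.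
   Context: $\mathbb{R}^n_{++}$ is the set of entrywise positive vectors; $\mathbf{e}_i$ is the $i$-th standard basis column vector. Irreducible: not permutation-similar to a block upper triangular matrix with at least two diagonal blocks; positive semidefinite: symmetric with nonnegative eigenvalues. A Perron vector is an eigenvector associated with the spectral radius $\rho(A)$. $a_k(A,\mathbf{x})=\max_i\frac{(A^k\mathbf{x})_i}{(A^{k-1}\mathbf{x})_i}$, $b_k(A,\mathbf{x})=\min_i\frac{(A^k\mathbf{x})_i}{(A^{k-1}\mathbf{x})_i}$ for $k\ge1$. An index $i_0$ is a log-concavity (resp. log-convexity) index of $A$ associated with $\mathbf{x}$ if there is $K>0$ with $\frac{(A^k\mathbf{x})_{i_0}}{(A^{k-1}\mathbf{x})_{i_0}}=a_k(A,\mathbf{x})$ (resp. $=b_k(A,\mathbf{x})$) for all $k\ge K$. A sequence $(z_m)$ is strictly log-concave (resp. strictly log-convex) if $z_{m-1}z_{m+1}<z_m^2$ (resp. $>$) for every interior index $m$. *)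

theory Defs
  imports "Jordan_Normal_Form.Spectral_Radius" "HOL-Combinatorics.Permutations"
begin

definition perm_mat :: "nat \<Rightarrow> (nat \<Rightarrow> nat) \<Rightarrow> real mat" where
  "perm_mat n p = mat n n (\<lambda>(i, j). if p i = j then 1 else 0)"

definition permutation_similar :: "real mat \<Rightarrow> real mat \<Rightarrow> bool" where
  "permutation_similar A B \<longleftrightarrow>
     (\<exists>p. p permutes {..<dim_row A} \<and>
        B = perm_mat (dim_row A) p * A * transpose_mat (perm_mat (dim_row A) p))"

text \<open>The map \<open>b\<close> sends an index to the number of the diagonal block that contains it:
  since \<open>b\<close> is monotone and onto \<open>{..<m}\<close>, its fibres are \<open>m\<close> nonempty consecutive
  intervals. Nothing is required of the diagonal blocks themselves.\<close>
definition block_upper_triangular :: "nat \<Rightarrow> real mat \<Rightarrow> bool" where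
  "block_upper_triangular m B \<longleftrightarrow> square_mat B \<and>
     (\<exists>b :: nat \<Rightarrow> nat. mono_on {..<dim_row B} b \<and> b ` {..<dim_row B} = {..<m} \<and>
        (\<forall>i<dim_row B. \<forall>j<dim_row B. b j < b i \<longrightarrow> B $$ (i, j) = 0))"

text \<open>By this convention every \<open>1 \<times> 1\<close> matrix, including the zero matrix, is irreducible.\<close>
definition irreducible_matrix :: "real mat \<Rightarrow> bool" where
  "irreducible_matrix A \<longleftrightarrow>
     \<not> (\<exists>B m. permutation_similar A B \<and> 2 \<le> m \<and> block_upper_triangular m B)"

definition positive_semidefinite :: "real mat \<Rightarrow> bool" where
  "positive_semidefinite A \<longleftrightarrow>
     transpose_mat A = A \<and> (\<forall>c. eigenvalue A c \<longrightarrow> 0 \<le> c)"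

text \<open>The order \<open><\<close> on vectors is not the entrywise strict one, hence a separate predicate.\<close>
definition positive_vec :: "real vec \<Rightarrow> bool" where
  "positive_vec v \<longleftrightarrow> (\<forall>i<dim_vec v. 0 < v $ i)"

text \<open>The spectral radius is that of the complex spectrum; the eigenvector is real.\<close>
definition perron_vector :: "real mat \<Rightarrow> real vec \<Rightarrow> bool" where
  "perron_vector A v \<longleftrightarrow> eigenvector A v (spectral_radius (map_mat complex_of_real A))"

text \<open>The quotients, maxima and minima below are used for \<open>k \<ge> 1\<close> only.\<close>
definition growth_ratio :: "real mat \<Rightarrow> real vec \<Rightarrow> nat \<Rightarrow> nat \<Rightarrow> real" where
  "growth_ratio A x k i = (A ^\<^sub>m k *\<^sub>v x) $ i / (A ^\<^sub>m (k - 1) *\<^sub>v x) $ i"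

definition max_ratio :: "real mat \<Rightarrow> real vec \<Rightarrow> nat \<Rightarrow> real" where
  "max_ratio A x k = Max (growth_ratio A x k ` {..<dim_row A})"

definition min_ratio :: "real mat \<Rightarrow> real vec \<Rightarrow> nat \<Rightarrow> real" where
  "min_ratio A x k = Min (growth_ratio A x k ` {..<dim_row A})"

definition log_concavity_index :: "real mat \<Rightarrow> real vec \<Rightarrow> nat \<Rightarrow> bool" where
  "log_concavity_index A x i \<longleftrightarrow>
     i < dim_row A \<and> (\<exists>K>0. \<forall>k\<ge>K. growth_ratio A x k i = max_ratio A x k)"

definition log_convexity_index :: "real mat \<Rightarrow> real vec \<Rightarrow> nat \<Rightarrow> bool" where
  "log_convexity_index A x i \<longleftrightarrow>
     i < dim_row A \<and> (\<exists>K>0. \<forall>k\<ge>K. growth_ratio A x k i = min_ratio A x k)"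

text \<open>These two concern the tail \<open>z s, z (s + 1), \<dots>\<close>, whose interior indices are the
  \<open>m > s\<close>.\<close>
definition strictly_log_concave_from :: "nat \<Rightarrow> (nat \<Rightarrow> real) \<Rightarrow> bool" where
  "strictly_log_concave_from s z \<longleftrightarrow> (\<forall>m>s. z (m - 1) * z (m + 1) < (z m)\<^sup>2)"

definition strictly_log_convex_from :: "nat \<Rightarrow> (nat \<Rightarrow> real) \<Rightarrow> bool" where
  "strictly_log_convex_from s z \<longleftrightarrow> (\<forall>m>s. z (m - 1) * z (m + 1) > (z m)\<^sup>2)"

end

theory Submission
  imports Defs
begin

text \<open>The matrix is similar to a triangular matrix with nonnegative diagonal, so each coordinate of
  the orbit \<open>A\<^sup>k x\<close> satisfies a linear recurrence with nonnegative characteristic roots. This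
  property is inherited by sums and products, and forces the sign to be eventually constant: if
  \<open>u (k + 1) - c u k\<close> eventually has constant sign for some \<open>c \<ge> 0\<close>, then so does \<open>u\<close>. Applied to
  the cross products of two coordinates, it shows that the growth ratios of any two coordinates
  are eventually comparable, hence some coordinate is eventually always maximal (minimal).

  Strictness only uses one step of the iteration. From \<open>A\<^sup>k x \<le> a\<^sub>k A\<^sup>k\<^sup>-\<^sup>1 x\<close> a positive row of \<open>A\<close>
  yields a strict inequality in the corresponding coordinate of \<open>A\<^sup>k\<^sup>+\<^sup>1 x\<close>, unless \<open>A\<^sup>k\<^sup>-\<^sup>1 x\<close> is a
  positive eigenvector; the latter is always a Perron vector. At a log-concavity index this
  is \<open>a\<^sub>k\<^sub>+\<^sub>1 < a\<^sub>k\<close>, and symmetrically for the minimum.\<close>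

section \<open>Linear recurrences with nonnegative characteristic roots\<close>

text \<open>With \<open>E\<close> the shift operator, these are the sequences annihilated by some
  finite product of factors \<open>E - c\<close> with \<open>c >= 0\<close>. The inductive form lets
  closure properties be proved by peeling off one factor at a time.\<close>

inductive nonneg_recurrent :: "(nat \<Rightarrow> real) \<Rightarrow> bool" where
  zero: "nonneg_recurrent (\<lambda>_. 0)"
| step: "0 \<le> c \<Longrightarrow> nonneg_recurrent (\<lambda>k. u (Suc k) - c * u k) \<Longrightarrow> nonneg_recurrent u"

text \<open>The factors \<open>E - c\<close> and \<open>E - d\<close> commute, so the product that
  annihilates \<open>u\<close> also annihilates its image. The sign of \<open>d\<close> is
  arbitrary; \<open>d = 0\<close> gives closure under the shift.\<close>

lemma nonneg_recurrent_diff_op: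
  assumes "nonneg_recurrent u"
  shows "nonneg_recurrent (\<lambda>k. u (Suc k) - d * u k)"
  using assms
proof induction
  case zero
  then show ?case by (simp add: nonneg_recurrent.zero)
next
  case (step c u)
  have "(\<lambda>k. (u (Suc (Suc k)) - c * u (Suc k)) - d * (u (Suc k) - c * u k)) =
        (\<lambda>k. (u (Suc (Suc k)) - d * u (Suc k)) - c * (u (Suc k) - d * u k))"
    by (auto simp: algebra_simps)
  with step.IH have "nonneg_recurrent (\<lambda>k. (u (Suc (Suc k)) - d * u (Suc k)) - c * (u (Suc k) - d * u k))"
    by simp
  with step.hyps(1) show ?case
    by (rule nonneg_recurrent.step)
qed

lemma nonneg_recurrent_Suc: "nonneg_recurrent u \<Longrightarrow> nonneg_recurrent (\<lambda>k. u (Suc k))"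
  using nonneg_recurrent_diff_op[of u 0] by simp

lemma nonneg_recurrent_cmult:
  assumes "nonneg_recurrent u"
  shows "nonneg_recurrent (\<lambda>k. d * u k)"
  using assms
proof induction
  case zero
  then show ?case by (simp add: nonneg_recurrent.zero)
next
  case (step c u)
  from step.IH have "nonneg_recurrent (\<lambda>k. d * u (Suc k) - c * (d * u k))"
    by (simp add: algebra_simps)
  with step.hyps(1) show ?case
    by (rule nonneg_recurrent.step)
qed

text \<open>Each factor peeled off \<open>u\<close> is applied to \<open>v\<close> as well, which
  keeps \<open>v\<close> in the class; hence the induction with \<open>v\<close> arbitrary.\<close>

lemma nonneg_recurrent_add:
  assumes "nonneg_recurrent u" "nonneg_recurrent v"
  shows "nonneg_recurrent (\<lambda>k. u k + v k)"
  using assms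
proof (induction arbitrary: v)
  case zero
  then show ?case by simp
next
  case (step c u)
  have "nonneg_recurrent (\<lambda>k. (u (Suc k) - c * u k) + (v (Suc k) - c * v k))"
    by (intro step.IH nonneg_recurrent_diff_op step.prems)
  then have "nonneg_recurrent (\<lambda>k. (u (Suc k) + v (Suc k)) - c * (u k + v k))"
    by (simp add: algebra_simps)
  with step.hyps(1) show ?case
    by (rule nonneg_recurrent.step)
qed

lemma nonneg_recurrent_diff:
  "nonneg_recurrent u \<Longrightarrow> nonneg_recurrent v \<Longrightarrow> nonneg_recurrent (\<lambda>k. u k - v k)"
  using nonneg_recurrent_add[OF _ nonneg_recurrent_cmult[of v "-1"], of u] by simp

lemma nonneg_recurrent_sum:
  assumes "\<And>j. j \<in> S \<Longrightarrow> nonneg_recurrent (u j)"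
  shows "nonneg_recurrent (\<lambda>k. \<Sum>j\<in>S. u j k)"
  using assms
  by (induction S rule: infinite_finite_induct)
    (simp_all add: nonneg_recurrent.zero nonneg_recurrent_add)

text \<open>Characteristic roots multiply, and products of nonnegative roots are nonnegative. A
  nested induction peels one root off each factor.\<close>

lemma nonneg_recurrent_mult:
  assumes "nonneg_recurrent u" "nonneg_recurrent v"
  shows "nonneg_recurrent (\<lambda>k. u k * v k)"
  using assms
proof (induction arbitrary: v)
  case zero
  then show ?case by (simp add: nonneg_recurrent.zero)
next
  case (step c u)
  note c = step.hyps(1) and outer_IH = step.IH
  from step.prems show ?case
  proof induction
    case zero
    then show ?case by (simp add: nonneg_recurrent.zero)
  next
    case (step d v)
    have "nonneg_recurrent v"
      using step.hyps by (rule nonneg_recurrent.step)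
    then have "nonneg_recurrent (\<lambda>k. (u (Suc k) - c * u k) * v (Suc k))"
      by (intro outer_IH nonneg_recurrent_Suc)
    \<comment> \<open>Discrete product rule:
      \<open>u' v' - c d u v = (u' - c u) v' + c u (v' - d v)\<close>, primes denoting the shift.
      The outer hypothesis covers the first summand, the inner one the second.\<close>
    from nonneg_recurrent_add[OF this nonneg_recurrent_cmult[OF step.IH, of c]]
    have "nonneg_recurrent (\<lambda>k. u (Suc k) * v (Suc k) - (c * d) * (u k * v k))"
      by (simp add: algebra_simps)
    moreover have "0 \<le> c * d" using c step.hyps(1) by simp
    ultimately show ?case
      by (rule nonneg_recurrent.step[rotated])
  qed
qed

text \<open>Beyond the threshold a nonnegative value stays nonnegative, since \<open>c >= 0\<close>;
  if no such value occurs, the tail is negative.\<close>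

lemma eventually_sign_of_growth:
  fixes u :: "nat \<Rightarrow> real"
  assumes "0 \<le> c" "\<forall>\<^sub>F k in sequentially. c * u k \<le> u (Suc k)"
  shows "(\<forall>\<^sub>F k in sequentially. 0 \<le> u k) \<or> (\<forall>\<^sub>F k in sequentially. u k \<le> 0)"
proof -
  from assms(2) obtain K where K: "\<And>k. k \<ge> K \<Longrightarrow> c * u k \<le> u (Suc k)"
    by (auto simp: eventually_sequentially)
  show ?thesis
  proof (cases "\<exists>l\<ge>K. 0 \<le> u l")
    case True
    then obtain l where l: "l \<ge> K" "0 \<le> u l" by auto
    have "0 \<le> u k" if "k \<ge> l" for k
      using that
    proof (induction rule: dec_induct)
      case base
      then show ?case by (fact l)
    next
      case (step k)
      then have "0 \<le> c * u k" using assms(1) by simp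
      also have "\<dots> \<le> u (Suc k)" using K l step by simp
      finally show ?case .
    qed
    then show ?thesis by (auto simp: eventually_sequentially)
  next
    case False
    then show ?thesis by (force simp: eventually_sequentially)
  qed
qed

text \<open>Nonnegativity of the roots is decisive: the root -1 would admit the alternating sequence
  \<open>(-1)^k\<close>.\<close>

lemma nonneg_recurrent_eventually_sign:
  assumes "nonneg_recurrent u"
  shows "(\<forall>\<^sub>F k in sequentially. 0 \<le> u k) \<or> (\<forall>\<^sub>F k in sequentially. u k \<le> 0)"
  using assms
proof induction
  case zero
  then show ?case by simp
next
  case (step c u)
  from step.IH show ?case
  proof
    assume "\<forall>\<^sub>F k in sequentially. 0 \<le> u (Suc k) - c * u k"
    then show ?thesis
      using eventually_sign_of_growth[OF step.hyps(1), of u] by simp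
  next
    assume "\<forall>\<^sub>F k in sequentially. u (Suc k) - c * u k \<le> 0"
    then show ?thesis
      using eventually_sign_of_growth[OF step.hyps(1), of "\<lambda>k. - u k"]
      by (simp add: disj_commute)
  qed
qed

section \<open>Matrices acting on vectors\<close>

lemma mult_mat_vec_sum:
  assumes "A \<in> carrier_mat n m" "v \<in> carrier_vec m" "i < n"
  shows "(A *\<^sub>v v) $ i = (\<Sum>j<m. A $$ (i, j) * v $ j)"
  using assms by (auto simp: scalar_prod_def atLeast0LessThan intro!: sum.cong)

text \<open>The power is defined with the new factor on the right, while iteration needs it on the
  left; \<open>A\<close> commutes with its powers.\<close>

lemma pow_mat_Suc_mult_vec:
  fixes A :: "'a :: comm_semiring_1 mat"
  assumes "A \<in> carrier_mat n n" "v \<in> carrier_vec n"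
  shows "A ^\<^sub>m Suc k *\<^sub>v v = A *\<^sub>v (A ^\<^sub>m k *\<^sub>v v)"
proof -
  have "A ^\<^sub>m k * A = A * A ^\<^sub>m k"
  proof (induction k)
    case (Suc k)
    have "A ^\<^sub>m Suc k * A = A * A ^\<^sub>m k * A" using Suc by simp
    also have "\<dots> = A * A ^\<^sub>m Suc k"
      using assoc_mult_mat[OF assms(1) pow_carrier_mat[OF assms(1), of k] assms(1)] by simp
    finally show ?case .
  qed (use assms(1) in auto)
  then show ?thesis using assms by (simp add: assoc_mult_mat_vec[of _ n n _ n])
qed

section \<open>Spectra of real symmetric matrices and recurrences for their powers\<close>

text \<open>For a complex eigenvector \<open>v\<close>, the form \<open>S\<close> (conjugate
  transpose of \<open>v\<close>, times \<open>A v\<close>) is real by symmetry and equals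
  \<open>c * N\<close>, where \<open>N\<close> is the squared norm of \<open>v\<close>, real and
  nonzero.\<close>

lemma symmetric_real_eigenvalue_real:
  fixes A :: "real mat"
  assumes A: "A \<in> carrier_mat n n" and sym: "transpose_mat A = A"
    and ev: "eigenvalue (map_mat complex_of_real A) c"
  shows "c \<in> \<real>"
proof -
  let ?A = "map_mat complex_of_real A"
  from ev obtain v where v: "v \<in> carrier_vec n" "v \<noteq> 0\<^sub>v n" "?A *\<^sub>v v = c \<cdot>\<^sub>v v"
    using A unfolding eigenvalue_def eigenvector_def by auto
  have sym': "A $$ (i, j) = A $$ (j, i)" if "i < n" "j < n" for i j
    using that A sym by (metis carrier_matD index_transpose_mat(1))
  have row: "(\<Sum>j<n. A $$ (i, j) * v $ j) = c * v $ i" if "i < n" for i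
    using that v A mult_mat_vec_sum[of ?A n n v i] by simp
  define S where "S = (\<Sum>i<n. \<Sum>j<n. cnj (v $ i) * A $$ (i, j) * v $ j)"
  define N where "N = (\<Sum>i<n. cnj (v $ i) * v $ i)"
  have S: "S = c * N"
    unfolding S_def N_def sum_distrib_left
    by (rule sum.cong) (simp_all add: row mult.assoc flip: sum_distrib_left)
  have "cnj S = (\<Sum>i<n. \<Sum>j<n. v $ i * A $$ (i, j) * cnj (v $ j))"
    unfolding S_def by simp
  also have "\<dots> = (\<Sum>j<n. \<Sum>i<n. v $ i * A $$ (i, j) * cnj (v $ j))"
    by (rule sum.swap)
  also have "\<dots> = S"
    unfolding S_def by (intro sum.cong) (auto simp: sym' mult_ac)
  finally have "cnj S = S" .
  moreover have "cnj N = N" unfolding N_def by (simp add: mult.commute)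
  ultimately have "cnj c * N = c * N" using S by (metis complex_cnj_mult)
  moreover have "N \<noteq> 0"
  proof
    assume "N = 0"
    have "N = of_real (\<Sum>i<n. (cmod (v $ i))\<^sup>2)"
      unfolding N_def of_real_sum
      by (rule sum.cong) (simp_all add: complex_norm_square mult.commute del: of_real_power)
    with \<open>N = 0\<close> have "(\<Sum>i<n. (cmod (v $ i))\<^sup>2) = 0" by (metis of_real_eq_0_iff)
    then have "\<forall>i<n. v $ i = 0" by (subst (asm) sum_nonneg_eq_0_iff) auto
    with v show False by auto
  qed
  ultimately show ?thesis by (simp add: Reals_cnj_iff)
qed

text \<open>The complex linear factors have real roots, and the factorization descends to the reals
  because the embedding is injective. This provides the list of roots that a real Schur
  decomposition takes as input.\<close>

lemma symmetric_char_poly_splits: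
  fixes A :: "real mat"
  assumes A: "A \<in> carrier_mat n n" and sym: "transpose_mat A = A"
  shows "\<exists>es. char_poly A = (\<Prod>e\<leftarrow>es. [:- e, 1:])"
proof -
  let ?A = "map_mat complex_of_real A"
  interpret of_real_poly: map_poly_inj_idom_hom "of_real :: real \<Rightarrow> complex" ..
  have A': "?A \<in> carrier_mat n n" using A by simp
  have char_poly: "char_poly ?A = map_poly complex_of_real (char_poly A)"
    using A by (rule of_real_hom.char_poly_hom)
  obtain cs where cs: "char_poly ?A = (\<Prod>c\<leftarrow>cs. [:- c, 1:])"
    using char_poly_factorized[OF A'] by auto
  have real: "complex_of_real (Re c) = c" if "c \<in> set cs" for c
  proof -
    have "poly (char_poly ?A) c = 0"
      unfolding cs using that by (rule linear_poly_root)
    then have "eigenvalue ?A c" by (simp add: eigenvalue_root_char_poly[OF A'])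
    then show ?thesis using symmetric_real_eigenvalue_real[OF A sym] by (simp add: of_real_Re)
  qed
  have "(\<Prod>c\<leftarrow>cs. [:- c, 1:]) = (\<Prod>c\<leftarrow>cs. map_poly complex_of_real [:- Re c, 1:])"
    by (intro arg_cong[of _ _ prod_list] map_cong) (auto simp: real)
  also have "\<dots> = map_poly complex_of_real (\<Prod>c\<leftarrow>cs. [:- Re c, 1:])"
    by (simp add: of_real_poly.hom_prod_list o_def)
  finally have "map_poly complex_of_real (char_poly A) = map_poly complex_of_real (\<Prod>c\<leftarrow>cs. [:- Re c, 1:])"
    using cs char_poly by simp
  then have "char_poly A = (\<Prod>c\<leftarrow>cs. [:- Re c, 1:])"
    by (simp add: poly_eq_iff coeff_map_poly)
  then show ?thesis
    by (intro exI[of _ "map Re cs"]) (simp add: o_def)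
qed

text \<open>Peeling off the root \<open>B $$ (i, i)\<close> leaves a combination of the coordinates
  below \<open>i\<close>, so the induction runs from the last coordinate upwards.\<close>

lemma nonneg_recurrent_upper_triangular_pow:
  fixes B :: "real mat"
  assumes B: "B \<in> carrier_mat n n" and ut: "upper_triangular B"
    and diag: "\<And>i. i < n \<Longrightarrow> 0 \<le> B $$ (i, i)"
    and v: "v \<in> carrier_vec n" and "i < n"
  shows "nonneg_recurrent (\<lambda>k. (B ^\<^sub>m k *\<^sub>v v) $ i)"
  using \<open>i < n\<close>
proof (induction "n - i" arbitrary: i rule: less_induct)
  case less
  have "(B ^\<^sub>m Suc k *\<^sub>v v) $ i - B $$ (i, i) * (B ^\<^sub>m k *\<^sub>v v) $ i =
      (\<Sum>j\<in>{i<..<n}. B $$ (i, j) * (B ^\<^sub>m k *\<^sub>v v) $ j)" for k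
  proof -
    have "(B ^\<^sub>m Suc k *\<^sub>v v) $ i = (\<Sum>j<n. B $$ (i, j) * (B ^\<^sub>m k *\<^sub>v v) $ j)"
      unfolding pow_mat_Suc_mult_vec[OF B v] using B v less.prems
      by (intro mult_mat_vec_sum mult_mat_vec_carrier[of _ n n] pow_carrier_mat)
    also have "\<dots> = (\<Sum>j\<in>{i..<n}. B $$ (i, j) * (B ^\<^sub>m k *\<^sub>v v) $ j)"
      using B ut less.prems by (intro sum.mono_neutral_right) auto
    also have "{i..<n} = insert i {i<..<n}" using less.prems by auto
    finally show ?thesis by simp
  qed
  moreover have "nonneg_recurrent (\<lambda>k. \<Sum>j\<in>{i<..<n}. B $$ (i, j) * (B ^\<^sub>m k *\<^sub>v v) $ j)"
    using less by (intro nonneg_recurrent_sum nonneg_recurrent_cmult) auto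
  ultimately have "nonneg_recurrent
      (\<lambda>k. (B ^\<^sub>m Suc k *\<^sub>v v) $ i - B $$ (i, i) * (B ^\<^sub>m k *\<^sub>v v) $ i)"
    by simp
  with diag[OF less.prems] show ?case by (rule nonneg_recurrent.step)
qed

text \<open>Schur form: \<open>A^k x = P (B^k (Q x))\<close> with \<open>B\<close> triangular and
  the eigenvalues of \<open>A\<close> on its diagonal. Each coordinate is thus a fixed linear
  combination of sequences from the triangular case.\<close>

lemma nonneg_recurrent_psd_pow:
  fixes A :: "real mat"
  assumes A: "A \<in> carrier_mat n n" and psd: "positive_semidefinite A"
    and x: "x \<in> carrier_vec n" and i: "i < n"
  shows "nonneg_recurrent (\<lambda>k. (A ^\<^sub>m k *\<^sub>v x) $ i)"
proof -
  obtain es where es: "char_poly A = (\<Prod>e\<leftarrow>es. [:- e, 1:])"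
    using symmetric_char_poly_splits[OF A] psd by (auto simp: positive_semidefinite_def)
  obtain B P Q where BPQ: "schur_decomposition A es = (B, P, Q)"
    by (cases "schur_decomposition A es") auto
  from schur_decomposition[OF A es BPQ]
  have sim: "similar_mat_wit A B P Q" and ut: "upper_triangular B" and d: "diag_mat B = es"
    by auto
  note carr = similar_mat_witD2[OF A sim]
  have "0 \<le> B $$ (j, j)" if "j < n" for j
  proof -
    have "B $$ (j, j) \<in> set es"
      using that carr unfolding d[symmetric] diag_mat_def by auto
    then have "poly (char_poly A) (B $$ (j, j)) = 0"
      unfolding es by (rule linear_poly_root)
    then show ?thesis
      using psd by (simp add: positive_semidefinite_def eigenvalue_root_char_poly[OF A])
  qed
  then have "nonneg_recurrent (\<lambda>k. \<Sum>j<n. P $$ (i, j) * (B ^\<^sub>m k *\<^sub>v (Q *\<^sub>v x)) $ j)"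
    using carr ut x
    by (intro nonneg_recurrent_sum nonneg_recurrent_cmult nonneg_recurrent_upper_triangular_pow)
      auto
  moreover have "(A ^\<^sub>m k *\<^sub>v x) $ i = (\<Sum>j<n. P $$ (i, j) * (B ^\<^sub>m k *\<^sub>v (Q *\<^sub>v x)) $ j)" for k
  proof -
    have Bk: "B ^\<^sub>m k \<in> carrier_mat n n" using carr by simp
    have "A ^\<^sub>m k *\<^sub>v x = P *\<^sub>v (B ^\<^sub>m k *\<^sub>v (Q *\<^sub>v x))"
      unfolding similar_mat_wit_pow_id[OF sim] using carr x Bk
      by (simp add: assoc_mult_mat_vec[of _ n n _ n])
    then show ?thesis using mult_mat_vec_sum[of P n n "B ^\<^sub>m k *\<^sub>v (Q *\<^sub>v x)" i] carr x i Bk by simp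
  qed
  ultimately show ?thesis by simp
qed

section \<open>Perron vectors and irreducibility\<close>

text \<open>The eigenvalue \<open>c\<close> is nonnegative, hence at most the spectral radius.
  Conversely, by symmetry \<open>v\<close> is also a left eigenvector, and pairing it with the
  moduli of any complex eigenvector bounds the modulus of its eigenvalue by
  \<open>c\<close>.\<close>

lemma positive_eigenvector_perron:
  fixes A :: "real mat"
  assumes n: "n \<ge> 1" and A: "A \<in> carrier_mat n n" and sym: "transpose_mat A = A"
    and nonneg: "\<And>i j. i < n \<Longrightarrow> j < n \<Longrightarrow> 0 \<le> A $$ (i, j)"
    and v: "v \<in> carrier_vec n" and pos: "\<And>i. i < n \<Longrightarrow> 0 < v $ i"
    and Av: "A *\<^sub>v v = c \<cdot>\<^sub>v v"
  shows "perron_vector A v"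
proof -
  let ?A = "map_mat complex_of_real A"
  have A': "?A \<in> carrier_mat n n" using A by simp
  have sym': "A $$ (i, j) = A $$ (j, i)" if "i < n" "j < n" for i j
    using that A sym by (metis carrier_matD index_transpose_mat(1))
  have row: "(\<Sum>j<n. A $$ (i, j) * v $ j) = c * v $ i" if "i < n" for i
    using that v A Av mult_mat_vec_sum[of A n n v i] by simp
  have ne: "v \<noteq> 0\<^sub>v n" using pos[of 0] n by auto
  have "0 \<le> (\<Sum>j<n. A $$ (0, j) * v $ j)"
    using n nonneg pos by (intro sum_nonneg mult_nonneg_nonneg) (auto intro: less_imp_le)
  then have "0 \<le> c * v $ 0" using row[of 0] n by simp
  then have c: "0 \<le> c" using pos[of 0] n by (simp add: zero_le_mult_iff)
  have "eigenvector A v c" using A v ne Av by (simp add: eigenvector_def)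
  then have "poly (char_poly A) c = 0"
    using eigenvalue_root_char_poly[OF A] by (auto simp: eigenvalue_def)
  then have "poly (map_poly complex_of_real (char_poly A)) (of_real c) = 0" by simp
  then have "eigenvalue ?A (of_real c)"
    by (simp add: eigenvalue_root_char_poly[OF A'] of_real_hom.char_poly_hom[OF A])
  then have "norm (complex_of_real c) \<in> norm ` spectrum ?A" unfolding spectrum_def by blast
  then have "c \<le> spectral_radius ?A"
    using spectral_radius_mem_max(2)[OF A'] n c by fastforce
  moreover have "spectral_radius ?A \<le> c"
  proof -
    obtain m where m: "eigenvalue ?A m" "spectral_radius ?A = norm m"
      using spectral_radius_mem_max(1)[OF A'] n unfolding spectrum_def by auto
    then obtain z where z: "z \<in> carrier_vec n" "z \<noteq> 0\<^sub>v n" "?A *\<^sub>v z = m \<cdot>\<^sub>v z"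
      using A unfolding eigenvalue_def eigenvector_def by auto
    have zrow: "(\<Sum>j<n. A $$ (i, j) * z $ j) = m * z $ i" if "i < n" for i
      using that z A mult_mat_vec_sum[of ?A n n z i] by simp
    \<comment> \<open>The norm of \<open>z\<close> weighted by the positive vector \<open>v\<close>;
      the aim is \<open>norm m * N <= c * N\<close>.\<close>
    define N where "N = (\<Sum>i<n. v $ i * norm (z $ i))"
    from z obtain l where l: "l < n" "z $ l \<noteq> 0" by (metis carrier_vecD eq_vecI index_zero_vec)
    have "0 < N" unfolding N_def
      by (rule sum_pos2[of _ l]) (use l pos in \<open>auto intro!: mult_nonneg_nonneg intro: less_imp_le\<close>)
    have "norm m * N = (\<Sum>i<n. v $ i * norm (\<Sum>j<n. A $$ (i, j) * z $ j))"
      unfolding N_def sum_distrib_left by (rule sum.cong) (auto simp: zrow norm_mult)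
    also have "\<dots> \<le> (\<Sum>i<n. v $ i * (\<Sum>j<n. A $$ (i, j) * norm (z $ j)))"
      using nonneg pos
      by (intro sum_mono mult_left_mono sum_norm_le) (auto simp: norm_mult intro: less_imp_le)
    also have "\<dots> = (\<Sum>j<n. \<Sum>i<n. v $ i * (A $$ (i, j) * norm (z $ j)))"
      unfolding sum_distrib_left by (rule sum.swap)
    \<comment> \<open>Symmetry moves \<open>A\<close> from the moduli of \<open>z\<close> onto
      \<open>v\<close>, where it acts as multiplication by \<open>c\<close>.\<close>
    also have "\<dots> = (\<Sum>j<n. (\<Sum>i<n. A $$ (j, i) * v $ i) * norm (z $ j))"
      unfolding sum_distrib_right by (intro sum.cong) (auto simp: sym' mult_ac)
    also have "\<dots> = c * N"
      unfolding N_def sum_distrib_left by (rule sum.cong) (auto simp: row)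
    finally show ?thesis using \<open>0 < N\<close> m by simp
  qed
  ultimately show ?thesis
    using \<open>eigenvector A v c\<close> by (simp add: perron_vector_def)
qed

text \<open>Swapping a zero row with the last one gives a block upper triangular form with diagonal
  blocks of sizes \<open>n - 1\<close> and 1; \<open>n >= 2\<close> makes the first block
  nonempty.\<close>

lemma irreducible_row_nonzero:
  assumes n: "n \<ge> 2" and A: "A \<in> carrier_mat n n" and irr: "irreducible_matrix A" and i: "i < n"
  shows "\<exists>j<n. A $$ (i, j) \<noteq> 0"
proof (rule ccontr)
  assume "\<not> ?thesis"
  then have zero: "A $$ (i, j) = 0" if "j < n" for j using that by blast
  define p where "p = Transposition.transpose i (n - 1)"
  define P where "P = perm_mat n p"
  define B where "B = P * A * transpose_mat P"
  define b :: "nat \<Rightarrow> nat" where "b = (\<lambda>j. if j < n - 1 then 0 else 1)"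
  have p: "p permutes {..<n}"
    unfolding p_def using n i by (intro permutes_swap_id) auto
  have P: "P \<in> carrier_mat n n" by (simp add: P_def perm_mat_def)
  have B: "B \<in> carrier_mat n n" unfolding B_def using P A by simp
  \<comment> \<open>Row \<open>n - 1\<close> of \<open>P\<close> selects row \<open>i\<close> of
    \<open>A\<close>, which vanishes.\<close>
  have PA: "row P (n - 1) \<bullet> col A k = 0" if "k < n" for k
  proof -
    have "row P (n - 1) \<bullet> col A k = (\<Sum>l<n. P $$ (n - 1, l) * A $$ (l, k))"
      using P A that n by (simp add: scalar_prod_def atLeast0LessThan)
    also have "\<dots> = 0"
      using n zero that by (intro sum.neutral) (auto simp: P_def perm_mat_def p_def)
    finally show ?thesis .
  qed
  have "B $$ (n - 1, j) = 0" if "j < n" for j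
  proof -
    have "row (P * A) (n - 1) = 0\<^sub>v n"
      using P A PA n by (intro eq_vecI) simp_all
    moreover have "B $$ (n - 1, j) = row (P * A) (n - 1) \<bullet> col (transpose_mat P) j"
      unfolding B_def using P A n that by (intro index_mult_mat(1)) auto
    ultimately show ?thesis using P that by simp
  qed
  moreover have "b ` {..<n} = {..<2}"
  proof
    have "b 0 = 0" "b (n - 1) = 1" using n by (auto simp: b_def)
    moreover have "0 \<in> {..<n}" "n - 1 \<in> {..<n}" using n by auto
    ultimately have "0 \<in> b ` {..<n}" "1 \<in> b ` {..<n}" by (metis imageI)+
    then show "{..<2} \<subseteq> b ` {..<n}" by (auto simp: less_2_cases_iff)
  qed (auto simp: b_def)
  \<comment> \<open>The only entries below the diagonal blocks lie in the last row.\<close>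
  moreover have "i' = n - 1" if "b j < b i'" "i' < n" for i' j
    using that by (auto simp: b_def split: if_splits)
  moreover have "mono_on {..<n} b" by (auto simp: b_def mono_on_def)
  ultimately have "block_upper_triangular 2 B"
    unfolding block_upper_triangular_def using B
    by (intro conjI exI[of _ b]) (simp_all, metis)
  moreover have "permutation_similar A B"
    unfolding permutation_similar_def using A p by (auto simp: B_def P_def)
  ultimately show False using irr unfolding irreducible_matrix_def by blast
qed

text \<open>Totality with \<open>i = j\<close> supplies reflexivity. The lemma is used with both
  orientations of the eventual comparison of growth ratios.\<close>

lemma finite_total_preorder_maximum:
  assumes "finite S" "S \<noteq> {}"
    and total: "\<And>i j. i \<in> S \<Longrightarrow> j \<in> S \<Longrightarrow> R i j \<or> R j i"
    and trans: "\<And>i j k. R i j \<Longrightarrow> R j k \<Longrightarrow> R i k"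
  shows "\<exists>m\<in>S. \<forall>j\<in>S. R m j"
  using assms(1,2) total
proof (induction rule: finite_ne_induct)
  case (singleton i)
  then show ?case by blast
next
  case (insert i S)
  then obtain m where "m \<in> S" "\<forall>j\<in>S. R m j" by blast
  then show ?case using insert.prems trans by (metis insert_iff)
qed

section \<open>Orbits of a nonnegative matrix\<close>

text \<open>Irreducibility enters through \<open>row_pos\<close>, which keeps every vector of the
  orbit positive, so that all growth ratios have positive denominators.\<close>

locale nonneg_orbit =
  fixes n :: nat and A :: "real mat" and x :: "real vec"
  assumes n: "n \<ge> 1" and A: "A \<in> carrier_mat n n"
    and nonneg: "\<And>i j. i < n \<Longrightarrow> j < n \<Longrightarrow> 0 \<le> A $$ (i, j)"
    and row_pos: "\<And>i. i < n \<Longrightarrow> \<exists>j<n. 0 < A $$ (i, j)"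
    and x: "x \<in> carrier_vec n" and x_pos: "\<And>i. i < n \<Longrightarrow> 0 < x $ i"
begin

definition orbit :: "nat \<Rightarrow> real vec" where
  "orbit k = A ^\<^sub>m k *\<^sub>v x"

lemma orbit_carrier: "orbit k \<in> carrier_vec n"
  unfolding orbit_def using A x by (intro mult_mat_vec_carrier[of _ n n] pow_carrier_mat)

lemma orbit_Suc: "orbit (Suc k) = A *\<^sub>v orbit k"
  unfolding orbit_def using A x by (rule pow_mat_Suc_mult_vec)

lemma orbit_Suc_sum: "i < n \<Longrightarrow> orbit (Suc k) $ i = (\<Sum>j<n. A $$ (i, j) * orbit k $ j)"
  unfolding orbit_Suc using A orbit_carrier by (rule mult_mat_vec_sum)

lemma orbit_pos: "i < n \<Longrightarrow> 0 < orbit k $ i"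
proof (induction k arbitrary: i)
  case 0
  then show ?case using x_pos A x by (simp add: orbit_def)
next
  case (Suc k)
  from row_pos[OF Suc.prems] obtain j where "j < n" "0 < A $$ (i, j)" by auto
  then have "0 < (\<Sum>j<n. A $$ (i, j) * orbit k $ j)"
    using Suc nonneg
    by (intro sum_pos2[of _ j]) (auto intro!: mult_nonneg_nonneg intro: less_imp_le)
  then show ?case using Suc.prems by (simp add: orbit_Suc_sum)
qed

lemma growth_ratio_Suc: "growth_ratio A x (Suc k) i = orbit (Suc k) $ i / orbit k $ i"
  by (simp add: growth_ratio_def orbit_def)

lemma orbit_le_max_ratio:
  assumes "i < n"
  shows "orbit (Suc k) $ i \<le> max_ratio A x (Suc k) * orbit k $ i"
proof -
  have "growth_ratio A x (Suc k) i \<le> max_ratio A x (Suc k)"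
    unfolding max_ratio_def using A assms by (intro Max_ge) auto
  then show ?thesis
    using orbit_pos[OF assms, of k] by (simp add: growth_ratio_Suc pos_divide_le_eq)
qed

lemma min_ratio_le_orbit:
  assumes "i < n"
  shows "min_ratio A x (Suc k) * orbit k $ i \<le> orbit (Suc k) $ i"
proof -
  have "min_ratio A x (Suc k) \<le> growth_ratio A x (Suc k) i"
    unfolding min_ratio_def using A assms by (intro Min_le) auto
  then show ?thesis
    using orbit_pos[OF assms, of k] by (simp add: growth_ratio_Suc pos_le_divide_eq)
qed

text \<open>Otherwise \<open>orbit k\<close> would be a positive eigenvector, hence a Perron
  vector.\<close>

lemma orbit_not_scaled:
  assumes sym: "transpose_mat A = A" and np: "\<not> perron_vector A (orbit k)"
  shows "\<exists>j<n. orbit (Suc k) $ j \<noteq> c * orbit k $ j"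
proof (rule ccontr)
  assume "\<not> ?thesis"
  then have "A *\<^sub>v orbit k = c \<cdot>\<^sub>v orbit k"
    using orbit_carrier[of k] orbit_carrier[of "Suc k"] unfolding orbit_Suc[symmetric]
    by (intro eq_vecI) auto
  then have "perron_vector A (orbit k)"
    using n A sym nonneg orbit_carrier orbit_pos by (intro positive_eigenvector_perron)
  with np show False by contradiction
qed

text \<open>The defect \<open>c * orbit k - orbit (Suc k)\<close> is nonnegative and nonzero, so its
  product with a positive row is strictly positive.\<close>

lemma orbit_Suc_Suc_less:
  assumes i: "i < n" "\<And>j. j < n \<Longrightarrow> 0 < A $$ (i, j)"
    and sym: "transpose_mat A = A" and np: "\<not> perron_vector A (orbit k)"
    and le: "\<And>j. j < n \<Longrightarrow> orbit (Suc k) $ j \<le> c * orbit k $ j"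
  shows "orbit (Suc (Suc k)) $ i < c * orbit (Suc k) $ i"
proof -
  obtain j where j: "j < n" "orbit (Suc k) $ j < c * orbit k $ j"
    using orbit_not_scaled[OF sym np, of c] le by force
  have "(\<Sum>j<n. A $$ (i, j) * orbit (Suc k) $ j) < (\<Sum>j<n. A $$ (i, j) * (c * orbit k $ j))"
    using i j le by (intro sum_strict_mono_ex1) (auto intro: less_imp_le)
  then show ?thesis using i by (simp add: orbit_Suc_sum[of i] sum_distrib_left mult_ac)
qed

text \<open>The same argument with the defect of opposite sign.\<close>

lemma orbit_Suc_Suc_greater:
  assumes i: "i < n" "\<And>j. j < n \<Longrightarrow> 0 < A $$ (i, j)"
    and sym: "transpose_mat A = A" and np: "\<not> perron_vector A (orbit k)"
    and ge: "\<And>j. j < n \<Longrightarrow> c * orbit k $ j \<le> orbit (Suc k) $ j"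
  shows "c * orbit (Suc k) $ i < orbit (Suc (Suc k)) $ i"
proof -
  obtain j where j: "j < n" "c * orbit k $ j < orbit (Suc k) $ j"
    using orbit_not_scaled[OF sym np, of c] ge by force
  have "(\<Sum>j<n. A $$ (i, j) * (c * orbit k $ j)) < (\<Sum>j<n. A $$ (i, j) * orbit (Suc k) $ j)"
    using i j ge by (intro sum_strict_mono_ex1) (auto intro: less_imp_le)
  then show ?thesis using i by (simp add: orbit_Suc_sum[of i] sum_distrib_left mult_ac)
qed

section \<open>Existence of log-concavity and log-convexity indices\<close>

text \<open>After clearing the positive denominators, the comparison is the sign of the cross
  product \<open>?w\<close>, a nonnegative recurrent sequence.\<close>

lemma growth_ratio_eventually_comparable:
  assumes psd: "positive_semidefinite A" and ij: "i < n" "j < n"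
  shows "(\<forall>\<^sub>F k in sequentially. growth_ratio A x k i \<le> growth_ratio A x k j) \<or>
         (\<forall>\<^sub>F k in sequentially. growth_ratio A x k j \<le> growth_ratio A x k i)"
proof -
  let ?w = "\<lambda>k. orbit (Suc k) $ j * orbit k $ i - orbit (Suc k) $ i * orbit k $ j"
  have rec: "nonneg_recurrent (\<lambda>k. orbit k $ l)" if "l < n" for l
    unfolding orbit_def using A psd x that by (rule nonneg_recurrent_psd_pow)
  have w: "nonneg_recurrent ?w"
    using rec[OF ij(1)] rec[OF ij(2)]
      nonneg_recurrent_Suc[OF rec[OF ij(1)]] nonneg_recurrent_Suc[OF rec[OF ij(2)]]
    by (intro nonneg_recurrent_diff nonneg_recurrent_mult)
  have "0 \<le> ?w k \<longleftrightarrow> growth_ratio A x (Suc k) i \<le> growth_ratio A x (Suc k) j"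
    "?w k \<le> 0 \<longleftrightarrow> growth_ratio A x (Suc k) j \<le> growth_ratio A x (Suc k) i" for k
    using orbit_pos[OF ij(1), of k] orbit_pos[OF ij(2), of k]
    by (simp_all add: growth_ratio_Suc frac_le_eq divide_le_0_iff zero_le_divide_iff field_simps)
  \<comment> \<open>\<open>?w k\<close> compares the ratios at \<open>Suc k\<close>; eventual
    statements are insensitive to this shift.\<close>
  with nonneg_recurrent_eventually_sign[OF w] show ?thesis
    by (simp add: eventually_sequentially_Suc[of "\<lambda>k. growth_ratio A x k i \<le> growth_ratio A x k j"]
        eventually_sequentially_Suc[of "\<lambda>k. growth_ratio A x k j \<le> growth_ratio A x k i"])
qed

lemma log_concavity_index_exists:
  assumes "positive_semidefinite A"
  shows "\<exists>i. log_concavity_index A x i"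
proof -
  define R where "R i j \<longleftrightarrow> (\<forall>\<^sub>F k in sequentially. growth_ratio A x k j \<le> growth_ratio A x k i)" for i j
  have "\<exists>i\<in>{..<n}. \<forall>j\<in>{..<n}. R i j"
  proof (rule finite_total_preorder_maximum)
    show "R i j \<or> R j i" if "i \<in> {..<n}" "j \<in> {..<n}" for i j
      using growth_ratio_eventually_comparable[OF assms, of i j] that by (auto simp: R_def)
    show "R i k" if "R i j" "R j k" for i j k
      using that unfolding R_def by eventually_elim simp
  qed (use n in \<open>auto simp: lessThan_empty_iff\<close>)
  then obtain i where i: "i < n" "\<forall>j\<in>{..<n}. R i j" by auto
  \<comment> \<open>Finitely many rivals \<open>j\<close> admit a common threshold.\<close>
  then have "\<forall>\<^sub>F k in sequentially. \<forall>j\<in>{..<n}. growth_ratio A x k j \<le> growth_ratio A x k i"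
    unfolding R_def by (intro eventually_ball_finite) auto
  then obtain K where K: "\<And>k j. k \<ge> K \<Longrightarrow> j < n \<Longrightarrow> growth_ratio A x k j \<le> growth_ratio A x k i"
    by (auto simp: eventually_sequentially)
  \<comment> \<open>\<open>Suc K\<close> rather than \<open>K\<close>, because the threshold of an
    index must be positive.\<close>
  have "growth_ratio A x k i = max_ratio A x k" if "k \<ge> Suc K" for k
    unfolding max_ratio_def using A K that i by (intro Max_eqI[symmetric]) auto
  then show ?thesis
    using i A unfolding log_concavity_index_def by (intro exI[of _ i] conjI exI[of _ "Suc K"]) auto
qed

text \<open>Same argument with the order reversed in \<open>R\<close>, so that the top element is
  eventually minimal.\<close>

lemma log_convexity_index_exists:
  assumes "positive_semidefinite A"
  shows "\<exists>i. log_convexity_index A x i"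
proof -
  define R where "R i j \<longleftrightarrow> (\<forall>\<^sub>F k in sequentially. growth_ratio A x k i \<le> growth_ratio A x k j)" for i j
  have "\<exists>i\<in>{..<n}. \<forall>j\<in>{..<n}. R i j"
  proof (rule finite_total_preorder_maximum)
    show "R i j \<or> R j i" if "i \<in> {..<n}" "j \<in> {..<n}" for i j
      using growth_ratio_eventually_comparable[OF assms, of i j] that by (auto simp: R_def)
    show "R i k" if "R i j" "R j k" for i j k
      using that unfolding R_def by eventually_elim simp
  qed (use n in \<open>auto simp: lessThan_empty_iff\<close>)
  then obtain i where i: "i < n" "\<forall>j\<in>{..<n}. R i j" by auto
  then have "\<forall>\<^sub>F k in sequentially. \<forall>j\<in>{..<n}. growth_ratio A x k i \<le> growth_ratio A x k j"
    unfolding R_def by (intro eventually_ball_finite) auto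
  then obtain K where K: "\<And>k j. k \<ge> K \<Longrightarrow> j < n \<Longrightarrow> growth_ratio A x k i \<le> growth_ratio A x k j"
    by (auto simp: eventually_sequentially)
  have "growth_ratio A x k i = min_ratio A x k" if "k \<ge> Suc K" for k
    unfolding min_ratio_def using A K that i by (intro Min_eqI[symmetric]) auto
  then show ?thesis
    using i A unfolding log_convexity_index_def by (intro exI[of _ i] conjI exI[of _ "Suc K"]) auto
qed

section \<open>Strict monotonicity of the extremal ratios\<close>

lemma max_ratio_strict:
  assumes idx: "log_concavity_index A x i" and row: "positive_vec (row A i)"
    and sym: "transpose_mat A = A" and np: "\<And>k. \<not> perron_vector A (orbit k)"
  shows "\<exists>K\<ge>1. strict_antimono_on {K..} (max_ratio A x) \<and>
    strictly_log_concave_from (K - 1) (\<lambda>k. orbit k $ i)"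
proof -
  from idx obtain K where i: "i < n" and "K > 0"
    and K: "\<And>k. k \<ge> K \<Longrightarrow> growth_ratio A x k i = max_ratio A x k"
    using A unfolding log_concavity_index_def by auto
  have pos: "0 < A $$ (i, j)" if "j < n" for j
    using row A i that by (auto simp: positive_vec_def)
  \<comment> \<open>Valid for every \<open>k\<close>; the threshold \<open>K\<close> matters only
    when an extremal ratio is identified with the ratio at \<open>i\<close>.\<close>
  have le: "orbit (Suc (Suc k)) $ i < max_ratio A x (Suc k) * orbit (Suc k) $ i" for k
    using i pos sym np orbit_le_max_ratio by (intro orbit_Suc_Suc_less)
  have decreasing: "max_ratio A x (Suc k) < max_ratio A x k" if kK: "k \<ge> K" for k
  proof -
    obtain l where k: "k = Suc l" using kK \<open>K > 0\<close> by (cases k) auto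
    have "max_ratio A x (Suc k) = orbit (Suc k) $ i / orbit k $ i"
      using K[of "Suc k"] kK by (simp add: growth_ratio_Suc)
    also have "\<dots> < max_ratio A x k"
      using le[of l] orbit_pos[OF i, of k] k by (simp add: pos_divide_less_eq)
    finally show ?thesis .
  qed
  have "max_ratio A x l < max_ratio A x k" if "k \<ge> K" "k < l" for k l
    \<comment> \<open>Downward induction on \<open>k\<close> with \<open>l\<close> fixed; the
      condition \<open>k >= K\<close> passes to \<open>Suc k\<close>.\<close>
    using that(2,1)
  proof (induction rule: strict_inc_induct)
    case (base k)
    then show ?case using decreasing by simp
  next
    case (step k)
    then show ?case using decreasing[of k] by simp
  qed
  then have "strict_antimono_on {K..} (max_ratio A x)"
    by (auto simp: monotone_on_def)
  moreover have "strictly_log_concave_from (K - 1) (\<lambda>k. orbit k $ i)"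
    unfolding strictly_log_concave_from_def
  proof (intro allI impI)
    fix m assume m: "K - 1 < m"
    then obtain l where l: "m = Suc l" by (cases m) auto
    \<comment> \<open>Since \<open>K > 0\<close>, \<open>K - 1 < m\<close> means
      \<open>m >= K\<close>, so the maximal ratio at \<open>m\<close> is attained at
      \<open>i\<close>. Clearing the denominator gives log-concavity.\<close>
    have "orbit (Suc m) $ i < orbit m $ i / orbit l $ i * orbit m $ i"
      using le[of l] K[of m] m \<open>K > 0\<close> by (simp add: l growth_ratio_Suc)
    then show "orbit (m - 1) $ i * orbit (m + 1) $ i < (orbit m $ i)\<^sup>2"
      using orbit_pos[OF i, of l] by (simp add: l field_simps power2_eq_square)
  qed
  ultimately show ?thesis using \<open>K > 0\<close> by (intro exI[of _ K]) auto
qed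

text \<open>Mirror image of the maximum: a positive row pushes the next ratio at \<open>i\<close>
  strictly above the current minimum.\<close>

lemma min_ratio_strict:
  assumes idx: "log_convexity_index A x i" and row: "positive_vec (row A i)"
    and sym: "transpose_mat A = A" and np: "\<And>k. \<not> perron_vector A (orbit k)"
  shows "\<exists>K\<ge>1. strict_mono_on {K..} (min_ratio A x) \<and>
    strictly_log_convex_from (K - 1) (\<lambda>k. orbit k $ i)"
proof -
  from idx obtain K where i: "i < n" and "K > 0"
    and K: "\<And>k. k \<ge> K \<Longrightarrow> growth_ratio A x k i = min_ratio A x k"
    using A unfolding log_convexity_index_def by auto
  have pos: "0 < A $$ (i, j)" if "j < n" for j
    using row A i that by (auto simp: positive_vec_def)
  have le: "min_ratio A x (Suc k) * orbit (Suc k) $ i < orbit (Suc (Suc k)) $ i" for k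
    using i pos sym np min_ratio_le_orbit by (intro orbit_Suc_Suc_greater)
  have increasing: "min_ratio A x k < min_ratio A x (Suc k)" if kK: "k \<ge> K" for k
  proof -
    obtain l where k: "k = Suc l" using kK \<open>K > 0\<close> by (cases k) auto
    have "min_ratio A x k < orbit (Suc k) $ i / orbit k $ i"
      using le[of l] orbit_pos[OF i, of k] k by (simp add: pos_less_divide_eq)
    also have "\<dots> = min_ratio A x (Suc k)"
      using K[of "Suc k"] kK by (simp add: growth_ratio_Suc)
    finally show ?thesis .
  qed
  have "min_ratio A x k < min_ratio A x l" if "k \<ge> K" "k < l" for k l
    using that(2,1)
  proof (induction rule: strict_inc_induct)
    case (base k)
    then show ?case using increasing by simp
  next
    case (step k)
    then show ?case using increasing[of k] by simp
  qed
  then have "strict_mono_on {K..} (min_ratio A x)"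
    by (auto simp: monotone_on_def)
  moreover have "strictly_log_convex_from (K - 1) (\<lambda>k. orbit k $ i)"
    unfolding strictly_log_convex_from_def
  proof (intro allI impI)
    fix m assume m: "K - 1 < m"
    then obtain l where l: "m = Suc l" by (cases m) auto
    have "orbit m $ i / orbit l $ i * orbit m $ i < orbit (Suc m) $ i"
      using le[of l] K[of m] m \<open>K > 0\<close> by (simp add: l growth_ratio_Suc)
    then show "orbit (m - 1) $ i * orbit (m + 1) $ i > (orbit m $ i)\<^sup>2"
      using orbit_pos[OF i, of l] by (simp add: l field_simps power2_eq_square)
  qed
  ultimately show ?thesis using \<open>K > 0\<close> by (intro exI[of _ K]) auto
qed

end

theorem theorem2p17:
  fixes n :: nat and A :: "real mat" and x :: "real vec"
  assumes "n \<ge> 1"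
    and "A \<in> carrier_mat n n"
    and "irreducible_matrix A"
    and "0\<^sub>m n n \<le> A"
    and "positive_semidefinite A"
    and "x \<in> carrier_vec n"
    and "positive_vec x"
  shows "(\<exists>i. log_concavity_index A x i) \<and> (\<exists>i. log_convexity_index A x i) \<and>
    (\<forall>i1 i2. log_concavity_index A x i1 \<longrightarrow> log_convexity_index A x i2 \<longrightarrow>
       positive_vec (row A i1) \<longrightarrow> positive_vec (row A i2) \<longrightarrow>
       (\<forall>r. \<not> perron_vector A (A ^\<^sub>m r *\<^sub>v x)) \<longrightarrow>
       (\<exists>k1\<ge>1. strict_antimono_on {k1..} (max_ratio A x) \<and>
          strictly_log_concave_from (k1 - 1) (\<lambda>k. (A ^\<^sub>m k *\<^sub>v x) $ i1)) \<and>
       (\<exists>k2\<ge>1. strict_mono_on {k2..} (min_ratio A x) \<and>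
          strictly_log_convex_from (k2 - 1) (\<lambda>k. (A ^\<^sub>m k *\<^sub>v x) $ i2)))"
proof (cases "n = 1")
  \<comment> \<open>Treated separately because the zero matrix of size 1 counts as irreducible and
    violates \<open>row_pos\<close>. Index 0 is extremal in both senses, and \<open>x\<close> itself
    is a Perron vector, which contradicts the non-Perron assumption at \<open>r = 0\<close>.\<close>
  case True
  have nonneg: "0 \<le> A $$ (i, j)" if "i < n" "j < n" for i j
    using assms(2,4) that by (auto simp: less_eq_mat_def)
  have "dim_row A = 1" using assms(2) True by simp
  then have ratios: "growth_ratio A x k 0 = max_ratio A x k" "growth_ratio A x k 0 = min_ratio A x k" for k
    by (simp_all add: max_ratio_def min_ratio_def lessThan_Suc)
  have "A *\<^sub>v x = A $$ (0, 0) \<cdot>\<^sub>v x"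
    using assms(2,6) True by (intro eq_vecI) (auto simp: scalar_prod_def)
  then have "perron_vector A x"
    using assms nonneg
    by (intro positive_eigenvector_perron[of n A x]) (auto simp: positive_semidefinite_def positive_vec_def)
  then have "perron_vector A (A ^\<^sub>m 0 *\<^sub>v x)" using assms(2,6) by simp
  moreover have "log_concavity_index A x 0" "log_convexity_index A x 0"
    using ratios \<open>dim_row A = 1\<close> unfolding log_concavity_index_def log_convexity_index_def by auto
  ultimately show ?thesis by blast
next
  case False
  have nonneg: "0 \<le> A $$ (i, j)" if "i < n" "j < n" for i j
    using assms(2,4) that by (auto simp: less_eq_mat_def)
  interpret nonneg_orbit n A x
  proof
    \<comment> \<open>A nonzero entry of a nonnegative matrix is positive.\<close>
    show "\<exists>j<n. 0 < A $$ (i, j)" if "i < n" for i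
      using irreducible_row_nonzero[of n A i] False assms that nonneg by force
  qed (use assms nonneg in \<open>auto simp: positive_vec_def\<close>)
  have sym: "transpose_mat A = A" using assms(5) by (simp add: positive_semidefinite_def)
  show ?thesis
    using log_concavity_index_exists[OF assms(5)] log_convexity_index_exists[OF assms(5)]
      max_ratio_strict[OF _ _ sym] min_ratio_strict[OF _ _ sym]
    unfolding orbit_def by blast
qed

end
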